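(* Let $n\in\mathbb{N}$, let $S=\{s_1,s_2,\dots,s_k\}\subsetneq\mathbb{Z}_n$ with $s_1<s_2<\dots<s_k$ (elements identified with their representatives in $\{0,1,\dots,n-1\}$) be such that $\langle S\rangle=\mathbb{Z}_n$ and $0\notin S$, let $w:S\to\mathbb{N}$ be a map, and assume $W=\sum_{j=1}^k w(s_j)\geq2$. Then $$\mathrm{Coker}(I_n-A_{C_n(S,w)}^t)\cong\mathrm{Coker}(T_{C_n(S,w)}^n-I_{s_k})$$ as abelian groups.
   Context: $\mathbb{N}=\{1,2,3,\dots\}$. $C_n(S,w)$ is the weighted Cayley graph of $\mathbb{Z}_n$: the directed graph with vertices $v_0,\dots,v_{n-1}$ (indices modulo $n$) and, for each $i$ and each $s\in S$, exactly $w(s)$ edges from $v_i$ to $v_{i+s}$. Its adjacency matrix $A_{C_n(S,w)}$ has $(i,j)$ entry equal to the number of edges from $v_i$ to $v_j$. $T_{C_n(S,w)}$ is the $s_k\times s_k$ companion matrix of the polynomial $t^{s_k}-\sum_{j=1}^k w(s_j)t^{s_k-s_j}$; that is, it has $1$'s on the subdiagonal, its last column $\mathbf{c}$ has entry $w(s_j)$ in position $s_k-s_j+1$ for each $j$ and (apart from the subdiagonal not meeting the last column) $0$ in the other positions, and all remaining entries are $0$. For $M\in M_m(\mathbb{Z})$, $\mathrm{Coker}(M)=\mathbb{Z}^m/M\mathbb{Z}^m$, where $M$ acts on column vectors by left multiplication. *)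

theory Defs
  imports
    "HOL-Algebra.Elementary_Groups"
    "HOL-Algebra.Generated_Groups"
    "HOL-Computational_Algebra.Polynomial"
    "Jordan_Normal_Form.Matrix"
    "Graph_Theory.Digraph"
begin

text \<open>Subsets of \<open>\<int>\<^sub>n\<close> are given by their sets of representatives \<open>S \<subseteq> {0..<n}\<close>.
  An arc \<open>(i, s, m)\<close> is the \<open>m\<close>-th of the \<open>w s\<close> parallel edges from \<open>v\<^sub>i\<close> to \<open>v\<^sub>i\<^sub>+\<^sub>s\<close>; only the
  values of \<open>w\<close> on \<open>S\<close> matter.\<close>

definition cayley_graph ::
    "nat \<Rightarrow> nat set \<Rightarrow> (nat \<Rightarrow> nat) \<Rightarrow> (nat, nat \<times> nat \<times> nat) pre_digraph" where
  "cayley_graph n S w =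
     \<lparr> verts = {0..<n},
       arcs = {(i, s, m). i \<in> {0..<n} \<and> s \<in> S \<and> m \<in> {0..<w s}},
       tail = (\<lambda>(i, s, m). i),
       head = (\<lambda>(i, s, m). (i + s) mod n) \<rparr>"

text \<open>For digraphs whose vertices are \<open>0, 1, \<dots>, N - 1\<close>, which also index rows and columns.\<close>

definition adjacency_mat :: "(nat, 'e) pre_digraph \<Rightarrow> int mat" where
  "adjacency_mat G =
     mat (card (verts G)) (card (verts G))
       (\<lambda>(i, j). int (card {e \<in> arcs G. tail G e = i \<and> head G e = j}))"

text \<open>The companion matrix of a monic polynomial, in the convention with ones on the subdiagonal
  and the negated coefficients, from the constant one downwards, in the last column.\<close>

definition companion_mat :: "'a::comm_ring_1 poly \<Rightarrow> 'a mat" where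
  "companion_mat p =
     mat (degree p) (degree p)
       (\<lambda>(i, j). if j = degree p - 1 then - coeff p i else if i = j + 1 then 1 else 0)"

definition T_poly :: "nat set \<Rightarrow> (nat \<Rightarrow> nat) \<Rightarrow> int poly" where
  "T_poly S w = monom 1 (Max S) - (\<Sum>s\<in>S. monom (int (w s)) (Max S - s))"

definition T_mat :: "nat set \<Rightarrow> (nat \<Rightarrow> nat) \<Rightarrow> int mat" where
  "T_mat S w = companion_mat (T_poly S w)"

text \<open>The cokernel \<open>\<int>\<^sup>m / M \<int>\<^sup>m\<close> of an integer matrix acting on column vectors. The group operation of
  \<open>monoid_vec\<close> is vector addition.\<close>

definition Coker :: "int mat \<Rightarrow> int vec set monoid" where
  "Coker M = monoid_vec TYPE(int) (dim_row M) Mod ((\<lambda>v. M *\<^sub>v v) ` carrier_vec (dim_col M))"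

lemma coeff_T_poly:
  assumes "finite S" "i \<le> Max S" "0 \<notin> S"
  shows "coeff (T_poly S w) i =
    (if i = Max S then 1 else if Max S - i \<in> S then - int (w (Max S - i)) else 0)"
proof -
  have "coeff (\<Sum>s\<in>S. monom (int (w s)) (Max S - s)) i
      = (\<Sum>s\<in>S. if s = Max S - i then int (w s) else 0)"
    unfolding coeff_sum coeff_monom
  proof (rule sum.cong[OF refl])
    fix s assume "s \<in> S"
    then have "s \<le> Max S" using assms(1) by simp
    then have "(Max S - s = i) = (s = Max S - i)" using assms(2) by arith
    then show "(if Max S - s = i then int (w s) else 0) = (if s = Max S - i then int (w s) else 0)"
      by simp
  qed
  also have "\<dots> = (if Max S - i \<in> S then int (w (Max S - i)) else 0)"
    using assms(1) by (simp add: sum.delta)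
  finally show ?thesis using assms by (auto simp: T_poly_def)
qed

lemma degree_T_poly:
  assumes "finite S" "0 \<notin> S"
  shows "degree (T_poly S w) = Max S"
proof (rule antisym)
  show "degree (T_poly S w) \<le> Max S"
    unfolding T_poly_def
    by (intro degree_diff_le degree_monom_le degree_sum_le assms(1))
       (use degree_monom_le diff_le_self le_trans in blast)
  show "Max S \<le> degree (T_poly S w)"
    by (rule le_degree) (use coeff_T_poly[OF assms(1) order_refl assms(2)] in simp)
qed

lemma T_mat_eq:
  assumes "finite S" "0 \<notin> S"
  shows "T_mat S w = mat (Max S) (Max S)
    (\<lambda>(i, j). if j = Max S - 1 then (if Max S - i \<in> S then int (w (Max S - i)) else 0)
              else if i = j + 1 then 1 else 0)"
  unfolding T_mat_def companion_mat_def degree_T_poly[OF assms]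
  by (rule eq_matI) (use assms in \<open>auto simp: coeff_T_poly\<close>)

end

theory Submission
  imports Defs
begin

text \<open>Write \<open>p\<close> for the polynomial whose companion matrix is \<open>T\<close>. Both cokernels are the additive group
  of \<open>\<int>[t] / (t\<^sup>n - 1, p)\<close>. On \<open>\<int>\<^sup>m \<cong> \<int>[t] / (p)\<close> the matrix \<open>T\<close> acts as multiplication by \<open>t\<close>,
  which gives the right-hand side. On \<open>\<int>\<^sup>n \<cong> \<int>[t] / (t\<^sup>n - 1)\<close>, with \<open>v\<^sub>i\<close> sent to \<open>t\<^sup>n\<^sup>-\<^sup>1\<^sup>-\<^sup>i\<close>, the
  matrix \<open>A\<^sup>t\<close> acts as multiplication by \<open>\<Sum>\<^sub>s w(s) t\<^sup>-\<^sup>s\<close>, and \<open>1 - \<Sum>\<^sub>s w(s) t\<^sup>-\<^sup>s\<close> is \<open>p\<close> times a power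
  of the unit \<open>t\<close>.\<close>

section \<open>Two-generator ideals as subgroups of the additive group of a ring\<close>

definition additive_group :: "'a::ab_group_add monoid" where
  "additive_group = \<lparr>carrier = UNIV, monoid.mult = (+), one = 0\<rparr>"

lemma additive_group_simps [simp]:
  "carrier additive_group = UNIV"
  "monoid.mult additive_group = (+)"
  "one additive_group = 0"
  by (simp_all add: additive_group_def)

lemma comm_group_additive_group: "comm_group (additive_group :: 'a::ab_group_add monoid)"
proof (rule comm_groupI)
  fix x :: 'a
  show "\<exists>y \<in> carrier additive_group. y \<otimes>\<^bsub>additive_group\<^esub> x = \<one>\<^bsub>additive_group\<^esub>"
    by (rule bexI[of _ "- x"]) simp_all
qed (simp_all add: ac_simps)

text \<open>The ideal generated by \<open>p\<close> and \<open>g\<close>. In use, \<open>p\<close>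
  is the monic polynomial defining the module and \<open>g\<close> the element by which the matrix
  acts.\<close>

definition ideal2 :: "'a::comm_ring_1 \<Rightarrow> 'a \<Rightarrow> 'a set" where
  "ideal2 p g = {a * p + b * g | a b. True}"

lemma ideal2I: "x = a * p + b * g \<Longrightarrow> x \<in> ideal2 p g"
  by (auto simp: ideal2_def)

lemma ideal2_commute: "ideal2 p g = ideal2 g p"
  unfolding ideal2_def by (auto, (metis add.commute)+)

text \<open>Since \<open>h\<close> is congruent to \<open>c * g\<close> modulo \<open>p\<close>, the
  generator \<open>h\<close> already lies in the ideal of \<open>p\<close> and
  \<open>g\<close>.\<close>

lemma ideal2_subsetI:
  assumes "p dvd h - c * g"
  shows "ideal2 p h \<subseteq> ideal2 p g"
proof
  fix x assume "x \<in> ideal2 p h"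
  then obtain a b where x: "x = a * p + b * h" by (auto simp: ideal2_def)
  from assms obtain k where "h - c * g = p * k" by (rule dvdE)
  then have h: "h = p * k + c * g" by (simp add: diff_eq_eq)
  show "x \<in> ideal2 p g"
    by (rule ideal2I[of _ "a + b * k" _ "b * c"]) (simp add: x h algebra_simps)
qed

lemma normal_ideal2: "ideal2 p g \<lhd> additive_group"
proof -
  interpret comm_group "additive_group :: 'a monoid" by (rule comm_group_additive_group)
  have "subgroup (ideal2 p g) additive_group"
  proof (rule subgroupI)
    have "0 \<in> ideal2 p g" by (rule ideal2I[of _ 0 _ 0]) simp
    then show "ideal2 p g \<noteq> {}" by blast
  next
    fix x assume "x \<in> ideal2 p g"
    then obtain a b where x: "x = a * p + b * g" by (auto simp: ideal2_def)
    have "inv\<^bsub>additive_group\<^esub> x = - x"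
      by (rule inv_equality) simp_all
    also have "\<dots> \<in> ideal2 p g"
      by (rule ideal2I[of _ "- a" _ "- b"]) (simp add: x)
    finally show "inv\<^bsub>additive_group\<^esub> x \<in> ideal2 p g" .
  next
    fix x y assume "x \<in> ideal2 p g" "y \<in> ideal2 p g"
    then obtain a b c d where "x = a * p + b * g" "y = c * p + d * g" by (auto simp: ideal2_def)
    then show "x \<otimes>\<^bsub>additive_group\<^esub> y \<in> ideal2 p g"
      by (intro ideal2I[of _ "a + c" _ "b + d"]) (simp add: algebra_simps)
  qed simp
  then show ?thesis by (rule subgroup_imp_normal)
qed

section \<open>Cokernels as quotients of a commutative ring\<close>

lemma group_Coker:
  assumes "M \<in> carrier_mat d d"
  shows "group (Coker M)"
proof -
  interpret V: comm_group "monoid_vec TYPE(int) d" by (rule comm_group_vec)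
  have "group_hom (monoid_vec TYPE(int) d) (monoid_vec TYPE(int) d) (\<lambda>v. M *\<^sub>v v)"
    using assms
    by (intro group_hom.intro group_hom_axioms.intro V.is_group homI)
       (auto simp: monoid_vec_simps mult_add_distrib_mat_vec)
  then have "subgroup ((\<lambda>v. M *\<^sub>v v) ` carrier_vec d) (monoid_vec TYPE(int) d)"
    using group_hom.img_is_subgroup by (fastforce simp: monoid_vec_simps)
  then have "(\<lambda>v. M *\<^sub>v v) ` carrier_vec d \<lhd> monoid_vec TYPE(int) d"
    by (rule V.subgroup_imp_normal)
  then show ?thesis
    using assms unfolding Coker_def by (auto intro: normal.factorgroup_is_group)
qed

text \<open>By \<open>add\<close>, \<open>surj\<close> and \<open>inj\<close>, \<psi> induces an
  additive isomorphism from Z^d to R/(p). By \<open>act\<close> it turns \<open>M\<close> into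
  multiplication by \<open>g\<close>, so the image of \<open>M\<close> becomes (p, g)/(p). The proof
  applies the first isomorphism theorem to the map sending \<open>v\<close> to the coset of
  \<open>\<psi> v\<close> modulo (p, g).\<close>

lemma Coker_iso_quotient:
  fixes \<psi> :: "int vec \<Rightarrow> 'a::comm_ring_1"
  assumes M: "M \<in> carrier_mat d d"
    and add: "\<And>u v. u \<in> carrier_vec d \<Longrightarrow> v \<in> carrier_vec d \<Longrightarrow> \<psi> (u + v) = \<psi> u + \<psi> v"
    and surj: "\<And>x. \<exists>v \<in> carrier_vec d. p dvd x - \<psi> v"
    and inj: "\<And>v. v \<in> carrier_vec d \<Longrightarrow> p dvd \<psi> v \<Longrightarrow> v = 0\<^sub>v d"
    and act: "\<And>v. v \<in> carrier_vec d \<Longrightarrow> p dvd \<psi> (M *\<^sub>v v) - g * \<psi> v"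
  shows "Coker M \<cong> additive_group Mod ideal2 p g"
proof -
  let ?V = "monoid_vec TYPE(int) d"
  let ?Q = "additive_group Mod ideal2 p g"
  let ?h = "\<lambda>v. ideal2 p g #>\<^bsub>additive_group\<^esub> \<psi> v"
  interpret V: comm_group ?V by (rule comm_group_vec)
  interpret A: comm_group "additive_group :: 'a monoid" by (rule comm_group_additive_group)
  interpret K: normal "ideal2 p g" additive_group by (rule normal_ideal2)
  have "\<psi> \<in> hom ?V additive_group"
    by (rule homI) (auto simp: monoid_vec_simps add)
  from hom_compose[OF this K.r_coset_hom_Mod] have "?h \<in> hom ?V ?Q"
    by (simp add: comp_def)
  then interpret h: group_hom ?V ?Q ?h
    by (intro group_hom.intro group_hom_axioms.intro V.is_group K.factorgroup_is_group)
  have diff: "\<psi> (u - v) = \<psi> u - \<psi> v" if "u \<in> carrier_vec d" "v \<in> carrier_vec d" for u v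
  proof -
    have "u - v + v = u" using that by auto
    then show ?thesis using add[of "u - v" v] that by simp
  qed
  have onto: "?h ` carrier ?V = carrier ?Q"
  proof
    show "carrier ?Q \<subseteq> ?h ` carrier ?V"
    proof
      fix X assume "X \<in> carrier ?Q"
      then obtain x where X: "X = ideal2 p g #>\<^bsub>additive_group\<^esub> x"
        by (auto simp: FactGroup_def RCOSETS_def)
      obtain v where v: "v \<in> carrier_vec d" "p dvd x - \<psi> v" using surj by blast
      then obtain k where "x - \<psi> v = p * k" by blast
      then have "x - \<psi> v \<in> ideal2 p g" by (intro ideal2I[of _ k _ 0]) (simp add: mult.commute)
      then have "x \<in> ?h v" by (auto simp: r_coset_def intro!: bexI[of _ "x - \<psi> v"])
      then have "X = ?h v"
        unfolding X by (intro A.repr_independence[symmetric]) (auto intro: K.subgroup_axioms)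
      then show "X \<in> ?h ` carrier ?V" using v by (auto simp: monoid_vec_simps)
    qed
  qed auto
  have "?h v = ideal2 p g \<longleftrightarrow> \<psi> v \<in> ideal2 p g" for v
    using A.coset_join1[of "ideal2 p g" "\<psi> v"] A.coset_join2[of "\<psi> v" "ideal2 p g"]
      K.subgroup_axioms by auto
  then have "kernel ?V ?Q ?h = {v \<in> carrier_vec d. \<psi> v \<in> ideal2 p g}"
    by (simp add: kernel_def monoid_vec_simps FactGroup_def)
  also have "\<dots> = (\<lambda>v. M *\<^sub>v v) ` carrier_vec d"
  proof (intro subset_antisym subsetI)
    fix v assume "v \<in> {v \<in> carrier_vec d. \<psi> v \<in> ideal2 p g}"
    then obtain a b where v: "v \<in> carrier_vec d" "\<psi> v = a * p + b * g"
      by (auto simp: ideal2_def)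
    \<comment> \<open>Lifting the coefficient \<open>b\<close> of \<open>g\<close> to a vector
      \<open>u\<close> gives the candidate preimage: \<psi> sends \<open>v - M *\<^sub>v u\<close>
      to a multiple of \<open>p\<close>, so \<open>inj\<close> forces this difference to
      vanish.\<close>
    obtain u where u: "u \<in> carrier_vec d" "p dvd b - \<psi> u" using surj by blast
    have "\<psi> (v - M *\<^sub>v u) = a * p + g * (b - \<psi> u) - (\<psi> (M *\<^sub>v u) - g * \<psi> u)"
      using v u M by (subst diff) (auto simp: algebra_simps)
    moreover have "p dvd a * p + g * (b - \<psi> u) - (\<psi> (M *\<^sub>v u) - g * \<psi> u)"
      by (intro dvd_diff dvd_add dvd_triv_right dvd_mult u act)
    ultimately have "v - M *\<^sub>v u = 0\<^sub>v d"
      using v u M by (intro inj) auto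
    then have "v = M *\<^sub>v u"
      using v u M by (auto simp: vec_eq_iff)
    then show "v \<in> (\<lambda>v. M *\<^sub>v v) ` carrier_vec d" using u by blast
  next
    fix v assume "v \<in> (\<lambda>v. M *\<^sub>v v) ` carrier_vec d"
    then obtain u where u: "u \<in> carrier_vec d" "v = M *\<^sub>v u" by blast
    from act[OF u(1)] obtain k where "\<psi> v - g * \<psi> u = p * k" unfolding u by blast
    then have "\<psi> v \<in> ideal2 p g"
      by (intro ideal2I[of _ k _ "\<psi> u"]) (simp add: algebra_simps)
    then show "v \<in> {v \<in> carrier_vec d. \<psi> v \<in> ideal2 p g}" using u M by auto
  qed
  finally have "kernel ?V ?Q ?h = (\<lambda>v. M *\<^sub>v v) ` carrier_vec d" .
  with h.FactGroup_iso[OF onto] show ?thesis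
    using M unfolding Coker_def by auto
qed

section \<open>Integer vectors as polynomials, and matrices acting on them\<close>

text \<open>The exponents \<pi> are a parameter because the two matrices need different orders of
  the monomial basis: the identity for the companion matrix, the reversal for the Cayley
  graph.\<close>

definition vec_poly :: "(nat \<Rightarrow> nat) \<Rightarrow> int vec \<Rightarrow> int poly" where
  "vec_poly \<pi> v = (\<Sum>i<dim_vec v. monom (v $ i) (\<pi> i))"

lemma vec_poly_add:
  assumes "u \<in> carrier_vec d" "v \<in> carrier_vec d"
  shows "vec_poly \<pi> (u + v) = vec_poly \<pi> u + vec_poly \<pi> v"
  using assms by (auto simp: vec_poly_def sum.distrib[symmetric] add_monom intro!: sum.cong)

lemma vec_poly_diff:
  assumes "u \<in> carrier_vec d" "v \<in> carrier_vec d"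
  shows "vec_poly \<pi> (u - v) = vec_poly \<pi> u - vec_poly \<pi> v"
  using assms by (auto simp: vec_poly_def sum_subtractf[symmetric] diff_monom intro!: sum.cong)

lemma vec_poly_mult_mat_vec:
  assumes "M \<in> carrier_mat d d" "v \<in> carrier_vec d"
  shows "vec_poly \<pi> (M *\<^sub>v v) = (\<Sum>j<d. Polynomial.smult (v $ j) (vec_poly \<pi> (col M j)))"
proof -
  have "vec_poly \<pi> (M *\<^sub>v v) = (\<Sum>i<d. \<Sum>j<d. monom (M $$ (i, j) * v $ j) (\<pi> i))"
    using assms
    by (auto simp: vec_poly_def scalar_prod_def monom_sum atLeast0LessThan intro!: sum.cong)
  also have "\<dots> = (\<Sum>j<d. \<Sum>i<d. monom (M $$ (i, j) * v $ j) (\<pi> i))"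
    by (rule sum.swap)
  also have "\<dots> = (\<Sum>j<d. Polynomial.smult (v $ j) (vec_poly \<pi> (col M j)))"
    using assms by (auto simp: vec_poly_def poly_eq_iff coeff_sum sum_distrib_left mult.commute intro!: sum.cong)
  finally show ?thesis .
qed

text \<open>Both terms of the difference are linear in \<open>v\<close>, so the congruence only has
  to be checked on basis vectors, that is, on the columns of \<open>M\<close>.\<close>

lemma vec_poly_action:
  assumes M: "M \<in> carrier_mat d d" and v: "v \<in> carrier_vec d"
    and cols: "\<And>j. j < d \<Longrightarrow> p dvd vec_poly \<pi> (col M j) - g * monom 1 (\<pi> j)"
  shows "p dvd vec_poly \<pi> (M *\<^sub>v v) - g * vec_poly \<pi> v"
proof -
  have "vec_poly \<pi> v = (\<Sum>j<d. Polynomial.smult (v $ j) (monom 1 (\<pi> j)))"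
    using v by (auto simp: vec_poly_def smult_monom)
  then have "vec_poly \<pi> (M *\<^sub>v v) - g * vec_poly \<pi> v
      = (\<Sum>j<d. Polynomial.smult (v $ j) (vec_poly \<pi> (col M j) - g * monom 1 (\<pi> j)))"
    by (simp add: vec_poly_mult_mat_vec[OF M v] sum_distrib_left sum_subtractf smult_diff_right)
  also have "p dvd \<dots>"
    by (intro dvd_sum dvd_smult cols) simp
  finally show ?thesis .
qed

text \<open>Division with remainder by the monic \<open>p\<close> makes 1, t, ..., t^(d-1) a basis
  of Z[t]/(p), and \<pi> merely permutes it. Hence \<open>vec_poly \<pi>\<close> satisfies
  \<open>surj\<close> and \<open>inj\<close> of \<open>Coker_iso_quotient\<close>.\<close>

lemma Coker_iso_poly_quotient:
  assumes M: "M \<in> carrier_mat d d" and "0 < d"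
    and \<pi>: "bij_betw \<pi> {..<d} {..<d}"
    and p: "degree p = d" "lead_coeff p = 1"
    and act: "\<And>v. v \<in> carrier_vec d \<Longrightarrow> p dvd vec_poly \<pi> (M *\<^sub>v v) - g * vec_poly \<pi> v"
  shows "Coker M \<cong> additive_group Mod ideal2 p g"
proof (rule Coker_iso_quotient[OF M vec_poly_add _ _ act])
  fix x
  have p0: "p \<noteq> 0" using p by auto
  \<comment> \<open>Pseudo-division scales \<open>x\<close> by a power of the leading coefficient of
    \<open>p\<close>. That coefficient is 1, so this is true division over the integers. A zero
    remainder has degree 0, which is below \<open>d\<close> by \<open>0 < d\<close>.\<close>
  obtain q r where qr: "pseudo_divmod x p = (q, r)" by fastforce
  from pseudo_divmod[OF p0 qr] p \<open>0 < d\<close> have x: "x = p * q + r" and r: "degree r < d"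
    by auto
  define v where "v = vec d (\<lambda>i. coeff r (\<pi> i))"
  have "vec_poly \<pi> v = (\<Sum>i<d. monom (coeff r (\<pi> i)) (\<pi> i))"
    by (auto simp: vec_poly_def v_def)
  also have "\<dots> = (\<Sum>j<d. monom (coeff r j) j)"
    by (rule sum.reindex_bij_betw[OF \<pi>])
  also have "\<dots> = (\<Sum>j\<le>degree r. monom (coeff r j) j)"
    using r by (intro sum.mono_neutral_right) (auto simp: coeff_eq_0)
  also have "\<dots> = r" by (rule poly_as_sum_of_monoms)
  finally show "\<exists>v \<in> carrier_vec d. p dvd x - vec_poly \<pi> v"
    by (intro bexI[of _ v]) (auto simp: x v_def)
next
  fix v :: "int vec" assume v: "v \<in> carrier_vec d" and dvd: "p dvd vec_poly \<pi> v"
  have lt: "\<pi> i < d" if "i < d" for i using \<pi> that by (auto simp: bij_betw_def)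
  \<comment> \<open>All exponents are below \<open>d\<close>, and a polynomial of degree less than
    that of its divisor \<open>p\<close> must be 0.\<close>
  have "degree (vec_poly \<pi> v) \<le> d - 1"
    unfolding vec_poly_def using v lt
    by (intro degree_sum_le order.trans[OF degree_monom_le]) fastforce+
  then have "degree (vec_poly \<pi> v) < degree p" using p \<open>0 < d\<close> by linarith
  with dvd have 0: "vec_poly \<pi> v = 0" using dvd_imp_degree_le by (metis leD)
  show "v = 0\<^sub>v d"
  proof
    fix i assume "i < dim_vec (0\<^sub>v d :: int vec)"
    then have i: "i < d" by simp
    \<comment> \<open>Injectivity of \<pi> ensures that no other entry of \<open>v\<close>
      contributes to the exponent \<open>\<pi> i\<close>.\<close>
    have "coeff (vec_poly \<pi> v) (\<pi> i) = (\<Sum>k<d. if k = i then v $ k else 0)"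
      unfolding vec_poly_def coeff_sum coeff_monom using \<pi> v i
      by (intro sum.cong) (auto simp: bij_betw_def inj_on_eq_iff)
    with 0 i show "v $ i = 0\<^sub>v d $ i" by simp
  qed (use v in simp)
qed

text \<open>One factor of \<open>M\<close> is applied to the vector first, so the induction
  hypothesis is needed at \<open>M *\<^sub>v v\<close>. The error then splits into that of
  \<open>M ^\<^sub>m k\<close> at this vector and g^k times that of a single
  \<open>M\<close>.\<close>

lemma vec_poly_pow_mat_action:
  assumes M: "M \<in> carrier_mat d d" and v: "v \<in> carrier_vec d"
    and act: "\<And>v. v \<in> carrier_vec d \<Longrightarrow> p dvd vec_poly \<pi> (M *\<^sub>v v) - g * vec_poly \<pi> v"
  shows "p dvd vec_poly \<pi> ((M ^\<^sub>m k) *\<^sub>v v) - g ^ k * vec_poly \<pi> v"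
  using v
proof (induction k arbitrary: v)
  case 0
  then show ?case using M by simp
next
  case (Suc k)
  have Mv: "M *\<^sub>v v \<in> carrier_vec d" using M Suc.prems by simp
  have "(M ^\<^sub>m Suc k) *\<^sub>v v = (M ^\<^sub>m k) *\<^sub>v (M *\<^sub>v v)"
    using M Suc.prems by (auto intro!: assoc_mult_mat_vec pow_carrier_mat)
  then have "vec_poly \<pi> ((M ^\<^sub>m Suc k) *\<^sub>v v) - g ^ Suc k * vec_poly \<pi> v
      = (vec_poly \<pi> ((M ^\<^sub>m k) *\<^sub>v (M *\<^sub>v v)) - g ^ k * vec_poly \<pi> (M *\<^sub>v v))
        + g ^ k * (vec_poly \<pi> (M *\<^sub>v v) - g * vec_poly \<pi> v)"
    by (simp add: algebra_simps)
  also have "p dvd \<dots>"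
    by (intro dvd_add dvd_mult Suc.IH[OF Mv] act Suc.prems)
  finally show ?case .
qed

section \<open>The companion matrix as multiplication by t\<close>

lemma companion_mat_action:
  assumes p: "lead_coeff p = 1" "degree p = d" and v: "v \<in> carrier_vec d"
  shows "p dvd vec_poly id (companion_mat p *\<^sub>v v) - monom 1 1 * vec_poly id v"
proof (rule vec_poly_action[OF _ v])
  show C: "companion_mat p \<in> carrier_mat d d" using p by (simp add: companion_mat_def)
  fix j assume j: "j < d"
  have "vec_poly id (col (companion_mat p) j) = (\<Sum>i<d. monom (companion_mat p $$ (i, j)) i)"
    using C j by (auto simp: vec_poly_def)
  \<comment> \<open>Every column but the last shifts t^j to t^(j+1). The last one holds t^d - p, the
    reduction of t^d modulo the monic \<open>p\<close>.\<close>
  also have "\<dots> = monom 1 (Suc j) - (if j = d - 1 then p else 0)"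
  proof (cases "j = d - 1")
    case True
    have "(\<Sum>i<d. monom (companion_mat p $$ (i, j)) i) = (\<Sum>i<d. - monom (coeff p i) i)"
      using True j p by (intro sum.cong) (auto simp: companion_mat_def minus_monom)
    moreover have "p = (\<Sum>i<d. monom (coeff p i) i) + monom 1 d"
      using poly_as_sum_of_monoms[of p] p by (simp add: lessThan_Suc_atMost[symmetric])
    ultimately show ?thesis using True j by (simp add: sum_negf algebra_simps)
  next
    case False
    have "(\<Sum>i<d. monom (companion_mat p $$ (i, j)) i) = (\<Sum>i<d. if i = Suc j then monom 1 i else 0)"
      using False j p by (intro sum.cong) (auto simp: companion_mat_def)
    then show ?thesis using False j by simp
  qed
  finally show "p dvd vec_poly id (col (companion_mat p) j) - monom 1 1 * monom 1 (id j)"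
    by (simp add: mult_monom)
qed

lemma lead_coeff_monom_minus_one:
  assumes "0 < n"
  shows "degree (monom 1 n - 1 :: int poly) = n" "lead_coeff (monom 1 n - 1 :: int poly) = 1"
proof -
  show d: "degree (monom 1 n - 1 :: int poly) = n"
    using assms degree_add_eq_left[of "- 1 :: int poly" "monom 1 n"] by (simp add: degree_monom_eq)
  show "lead_coeff (monom 1 n - 1 :: int poly) = 1"
    using assms unfolding d by simp
qed

section \<open>The transposed adjacency matrix modulo t^n - 1\<close>

lemma adjacency_cayley_entry:
  assumes "finite S" "i < n" "j < n"
  shows "adjacency_mat (cayley_graph n S w) $$ (i, j) = (\<Sum>s\<in>S. if (i + s) mod n = j then int (w s) else 0)"
proof -
  \<comment> \<open>The arcs from \<open>i\<close> to \<open>j\<close> are grouped by their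
    generator \<open>s\<close>; each admissible \<open>s\<close> carries \<open>w s\<close> parallel
    copies.\<close>
  have "{e \<in> arcs (cayley_graph n S w). tail (cayley_graph n S w) e = i \<and> head (cayley_graph n S w) e = j}
      = (\<lambda>(s, m). (i, s, m)) ` (SIGMA s:{s \<in> S. (i + s) mod n = j}. {0..<w s})"
    using assms by (auto simp: cayley_graph_def image_iff)
  moreover have "inj_on (\<lambda>(s, m). (i, s, m)) (SIGMA s:{s \<in> S. (i + s) mod n = j}. {0..<w s})"
    by (auto simp: inj_on_def)
  ultimately have "card {e \<in> arcs (cayley_graph n S w).
      tail (cayley_graph n S w) e = i \<and> head (cayley_graph n S w) e = j}
      = (\<Sum>s | s \<in> S \<and> (i + s) mod n = j. w s)"
    using assms(1) by (simp add: card_image)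
  moreover have "card (verts (cayley_graph n S w)) = n" by (simp add: cayley_graph_def)
  ultimately show ?thesis
    using assms by (simp add: adjacency_mat_def sum.inter_filter if_distrib[of int] cong: if_cong)
qed

text \<open>Modulo t^n - 1 the monomial t^(n-s) stands for t^(-s). As v_j is encoded by t^(n-1-j),
  multiplying by it moves v_j to v_(j+s). Without wraparound the two exponents differ by exactly
  \<open>n\<close>; with wraparound they coincide.\<close>

lemma reverse_index_shift:
  fixes n :: nat
  assumes "j < n" "s < n"
  shows "(monom 1 n - 1 :: int poly) dvd
    monom 1 (n - s) * monom 1 (n - 1 - j) - monom 1 (n - 1 - (j + s) mod n)"
proof (cases "j + s < n")
  case True
  then have "(n - s) + (n - 1 - j) = n + (n - 1 - (j + s))" by arith
  then have "monom 1 (n - s) * monom 1 (n - 1 - j) - monom 1 (n - 1 - (j + s) mod n)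
      = (monom 1 n - 1 :: int poly) * monom 1 (n - 1 - (j + s))"
    using True by (simp add: mult_monom left_diff_distrib)
  then show ?thesis by simp
next
  case False
  then have "(j + s) mod n = j + s - n" using assms by (simp add: mod_if)
  moreover have "(n - s) + (n - 1 - j) = n - 1 - (j + s - n)" using False assms by arith
  ultimately show ?thesis by (simp add: mult_monom)
qed

text \<open>Column \<open>j\<close> of the transpose lists the arcs leaving v_j, so it is the sum
  over \<open>s\<close> of w(s) times the basis vector at (j + s) mod n. Each summand is handled by
  \<open>reverse_index_shift\<close>.\<close>

lemma cayley_adjacency_action:
  fixes w :: "nat \<Rightarrow> nat"
  assumes S: "S \<subseteq> {0..<n}" and v: "v \<in> carrier_vec n"
  defines "B \<equiv> transpose_mat (adjacency_mat (cayley_graph n S w))"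
  defines "\<pi> \<equiv> \<lambda>i. n - 1 - i"
  shows "monom 1 n - 1 dvd vec_poly \<pi> (B *\<^sub>v v) - (\<Sum>s\<in>S. monom (int (w s)) (n - s)) * vec_poly \<pi> v"
proof (rule vec_poly_action[OF _ v])
  have fin: "finite S" using S finite_subset by blast
  show B: "B \<in> carrier_mat n n"
    by (simp add: B_def adjacency_mat_def cayley_graph_def)
  fix j assume j: "j < n"
  have "vec_poly \<pi> (col B j) = (\<Sum>i<n. monom (B $$ (i, j)) (\<pi> i))"
    using B j by (auto simp: vec_poly_def)
  also have "\<dots> = (\<Sum>i<n. \<Sum>s\<in>S. if i = (j + s) mod n then monom (int (w s)) (\<pi> i) else 0)"
  proof (rule sum.cong[OF refl])
    fix i assume "i \<in> {..<n}"
    then have "B $$ (i, j) = (\<Sum>s\<in>S. if (j + s) mod n = i then int (w s) else 0)"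
      using j B by (simp add: B_def adjacency_cayley_entry[OF fin])
    then show "monom (B $$ (i, j)) (\<pi> i) = (\<Sum>s\<in>S. if i = (j + s) mod n then monom (int (w s)) (\<pi> i) else 0)"
      by (auto simp: monom_sum intro!: sum.cong)
  qed
  also have "\<dots> = (\<Sum>s\<in>S. Polynomial.smult (int (w s)) (monom 1 (\<pi> ((j + s) mod n))))"
    \<comment> \<open>For fixed \<open>s\<close>, the sum over \<open>i\<close> has the single term
      \<open>i = (j + s) mod n\<close>.\<close>
    using j by (subst sum.swap) (auto simp: smult_monom intro!: sum.cong)
  \<comment> \<open>The difference is taken with the opposite sign to match
    \<open>reverse_index_shift\<close>; divisibility survives the negation at the end.\<close>
  finally have "(\<Sum>s\<in>S. monom (int (w s)) (n - s)) * monom 1 (\<pi> j) - vec_poly \<pi> (col B j)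
      = (\<Sum>s\<in>S. Polynomial.smult (int (w s)) (monom 1 (n - s) * monom 1 (\<pi> j) - monom 1 (\<pi> ((j + s) mod n))))"
    by (simp add: sum_distrib_right sum_subtractf[symmetric] smult_diff_right mult_monom smult_monom)
  also have "monom 1 n - 1 dvd \<dots>"
    using S j unfolding \<pi>_def by (intro dvd_sum dvd_smult reverse_index_shift) auto
  finally show "monom 1 n - 1 dvd vec_poly \<pi> (col B j) - (\<Sum>s\<in>S. monom (int (w s)) (n - s)) * monom 1 (\<pi> j)"
    by (metis dvd_minus_iff minus_diff_eq)
qed

section \<open>Comparison of the two ideals\<close>

lemma T_poly_unit_multiple:
  fixes w :: "nat \<Rightarrow> nat"
  assumes S: "S \<subseteq> {0..<n}"
  shows "monom 1 n - 1 dvd T_poly S w - monom 1 (Max S) * (1 - (\<Sum>s\<in>S. monom (int (w s)) (n - s)))"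
proof -
  have fin: "finite S" using S finite_subset by blast
  have "T_poly S w - monom 1 (Max S) * (1 - (\<Sum>s\<in>S. monom (int (w s)) (n - s)))
      = (\<Sum>s\<in>S. monom (int (w s)) (Max S + (n - s)) - monom (int (w s)) (Max S - s))"
    by (simp add: T_poly_def right_diff_distrib sum_distrib_left mult_monom sum_subtractf)
  also have "\<dots> = (\<Sum>s\<in>S. (monom 1 n - 1) * monom (int (w s)) (Max S - s))"
  proof (rule sum.cong[OF refl])
    fix s assume "s \<in> S"
    then have "s \<le> Max S" "s < n" using fin S by auto
    \<comment> \<open>Both \<open>s \<le> Max S\<close> and \<open>s < n\<close> are needed for the
      truncated subtractions to be exact. The two exponents then differ by \<open>n\<close>, which
      produces the factor t^n - 1.\<close>
    then have "Max S + (n - s) = n + (Max S - s)" by arith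
    then show "monom (int (w s)) (Max S + (n - s)) - monom (int (w s)) (Max S - s)
        = (monom 1 n - 1) * monom (int (w s)) (Max S - s)"
      by (simp add: left_diff_distrib mult_monom)
  qed
  also have "monom 1 n - 1 dvd \<dots>" by (intro dvd_sum dvd_triv_left)
  finally show ?thesis .
qed

text \<open>Modulo t^n - 1 the power t^(Max S) is a unit with inverse t^(n - Max S), so by
  \<open>T_poly_unit_multiple\<close> the two second generators are associates.\<close>

lemma ideal2_T_poly:
  fixes w :: "nat \<Rightarrow> nat"
  assumes S: "S \<subseteq> {0..<n}" "S \<noteq> {}"
  shows "ideal2 (monom 1 n - 1) (1 - (\<Sum>s\<in>S. monom (int (w s)) (n - s)))
    = ideal2 (monom 1 n - 1) (T_poly S w)"
proof (rule subset_antisym)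
  let ?E = "monom 1 n - 1 :: int poly" and ?T = "T_poly S w" and ?m = "Max S"
  let ?g = "1 - (\<Sum>s\<in>S. monom (int (w s)) (n - s))"
  have "?m < n" using S finite_subset[OF S(1)] by (metis Max_in atLeastLessThan_iff finite_atLeastLessThan subsetD)
  then have "monom 1 (n - ?m) * (monom 1 ?m * ?g) = monom 1 n * ?g"
    by (simp add: mult.assoc[symmetric] mult_monom)
  \<comment> \<open>The multiplier for \<open>ideal2_subsetI\<close> is the inverse unit t^(n - Max
    S).\<close>
  then have "?g - monom 1 (n - ?m) * ?T
      = - (?E * ?g) - monom 1 (n - ?m) * (?T - monom 1 ?m * ?g)"
    by (simp add: algebra_simps)
  also have "?E dvd \<dots>"
    by (intro dvd_diff dvd_mult T_poly_unit_multiple S) simp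
  finally show "ideal2 ?E ?g \<subseteq> ideal2 ?E ?T" by (rule ideal2_subsetI)
  show "ideal2 ?E ?T \<subseteq> ideal2 ?E ?g"
    by (rule ideal2_subsetI[OF T_poly_unit_multiple[OF S(1)]])
qed

theorem theorem3p9:
  fixes n :: nat and S :: "nat set" and w :: "nat \<Rightarrow> nat"
  assumes "n \<ge> 1"
    and "S \<subset> {0..<n}"
    and "generate (integer_mod_group n) (int ` S) = carrier (integer_mod_group n)"
    and "0 \<notin> S"
    and "\<And>s. s \<in> S \<Longrightarrow> w s \<ge> 1"
    and "(\<Sum>s\<in>S. w s) \<ge> 2"
  shows "Coker (1\<^sub>m n - transpose_mat (adjacency_mat (cayley_graph n S w)))
       \<cong> Coker (T_mat S w ^\<^sub>m n - 1\<^sub>m (Max S))"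
proof -
  let ?B = "transpose_mat (adjacency_mat (cayley_graph n S w))"
  let ?E = "monom 1 n - 1 :: int poly" and ?T = "T_poly S w" and ?m = "Max S"
  let ?g = "1 - (\<Sum>s\<in>S. monom (int (w s)) (n - s))"
  \<comment> \<open>An empty \<open>S\<close> would have total weight 0.\<close>
  have S: "S \<subseteq> {0..<n}" "S \<noteq> {}" and fin: "finite S"
    using assms finite_subset by auto
  have "?m \<in> S" using S fin by simp
  with assms(4) have m: "0 < ?m" by (cases "?m") auto
  have degT: "degree ?T = ?m" using degree_T_poly fin assms(4) by blast
  have T: "degree ?T = ?m" "lead_coeff ?T = 1"
    using degT coeff_T_poly[OF fin order_refl assms(4)] by simp_all
  have B: "?B \<in> carrier_mat n n"
    by (simp add: adjacency_mat_def cayley_graph_def)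
  have C: "T_mat S w \<in> carrier_mat ?m ?m" "T_mat S w ^\<^sub>m n \<in> carrier_mat ?m ?m"
    using T by (simp_all add: T_mat_def companion_mat_def pow_carrier_mat)
  have "Coker (1\<^sub>m n - ?B) \<cong> additive_group Mod ideal2 ?E ?g"
  proof (rule Coker_iso_poly_quotient[where \<pi> = "\<lambda>i. n - 1 - i"])
    show "bij_betw (\<lambda>i. n - 1 - i) {..<n} {..<n}"
      by (rule bij_betw_byWitness[where f' = "\<lambda>i. n - 1 - i"]) auto
    fix v :: "int vec" assume v: "v \<in> carrier_vec n"
    \<comment> \<open>Subtracting from the identity negates the error term of the action of
      \<open>?B\<close>.\<close>
    have "vec_poly (\<lambda>i. n - 1 - i) ((1\<^sub>m n - ?B) *\<^sub>v v) - ?g * vec_poly (\<lambda>i. n - 1 - i) v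
        = - (vec_poly (\<lambda>i. n - 1 - i) (?B *\<^sub>v v)
            - (\<Sum>s\<in>S. monom (int (w s)) (n - s)) * vec_poly (\<lambda>i. n - 1 - i) v)"
      using B v by (simp add: minus_mult_distrib_mat_vec[of _ n n] vec_poly_diff[of _ n] left_diff_distrib)
    with cayley_adjacency_action[OF S(1) v]
    show "?E dvd vec_poly (\<lambda>i. n - 1 - i) ((1\<^sub>m n - ?B) *\<^sub>v v) - ?g * vec_poly (\<lambda>i. n - 1 - i) v"
      by (metis dvd_minus_iff)
  qed (use assms B lead_coeff_monom_minus_one[of n] in auto)
  \<comment> \<open>Besides replacing \<open>?g\<close> by \<open>?T\<close>, this exchanges the
    roles of the generators: now \<open>?T\<close> is the modulus and \<open>?E\<close> the acting
    element.\<close>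
  also have "ideal2 ?E ?g = ideal2 ?T ?E"
    using ideal2_T_poly[OF S] ideal2_commute by metis
  also have "additive_group Mod ideal2 ?T ?E \<cong> Coker (T_mat S w ^\<^sub>m n - 1\<^sub>m ?m)"
  \<comment> \<open>The isomorphism is constructed out of the cokernel; reversing it requires the
    cokernel to be a group.\<close>
  proof (rule group.iso_sym[OF group_Coker])
    show "Coker (T_mat S w ^\<^sub>m n - 1\<^sub>m ?m) \<cong> additive_group Mod ideal2 ?T ?E"
    proof (rule Coker_iso_poly_quotient[where \<pi> = id, OF _ m _ T])
      fix v :: "int vec" assume v: "v \<in> carrier_vec ?m"
      \<comment> \<open>The companion matrix acts as t, so its n-th power acts as t^n, and
        subtracting the identity gives \<open>?E\<close>.\<close>
      have "?T dvd vec_poly id ((T_mat S w ^\<^sub>m n) *\<^sub>v v) - monom 1 1 ^ n * vec_poly id v"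
        by (rule vec_poly_pow_mat_action[OF C(1) v])
           (unfold T_mat_def, rule companion_mat_action[OF T(2,1)])
      then show "?T dvd vec_poly id ((T_mat S w ^\<^sub>m n - 1\<^sub>m ?m) *\<^sub>v v) - ?E * vec_poly id v"
        using C v mult_mat_vec_carrier[OF C(2) v]
        by (simp add: minus_mult_distrib_mat_vec[of _ ?m ?m] vec_poly_diff[of _ ?m]
            left_diff_distrib monom_power diff_diff_eq2 diff_add_eq[symmetric])
    qed (use C in auto)
  qed (use C in auto)
  finally show ?thesis .
qed

end
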